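(* Let $\varphi\colon\mathbb{N}\to\mathbb{R}$ be a function satisfying $\varphi(n+1)-\varphi(n)\to\infty$ as $n\to\infty$. Then for any real numbers $q>1$ and $\lambda>0$, the similarity transformation $H_\lambda$ keeps the space $X_\varphi=\{q^{\varphi(n)}:n\in\mathbb{N}\}\subset\mathbb{R}$, endowed with the metric induced from $\mathbb{R}$, in the same cloud (i.e., $\lambda X_\varphi$ lies in the cloud containing $X_\varphi$) if and only if $\lambda=1$.
   Context: $\mathbb{N}$ is the set of positive integers. The Gromov--Hausdorff distance $d_{GH}(X,Y)\in[0,\infty]$ between non-empty metric spaces is the infimum of the Hausdorff distances $d_H(X',Y')$ over all metric spaces $Z$ and all subsets $X',Y'\subset Z$ isometric to $X$ and $Y$ respectively; it is a generalized pseudometric on the class of all non-empty metric spaces considered up to isometry (the value $\infty$ is allowed). A cloud is an equivalence class of the relation $d_{GH}(X,Y)<\infty$ on this class. For a metric space $X$ and real $\lambda>0$, $\lambda X$ is the metric space obtained from $X$ by multiplying all distances by $\lambda$, and $H_\lambda\colon X\mapsto\lambda X$ is the similarity transformation with coefficient $\lambda$. *)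

theory Defs
  imports "HOL-Analysis.Analysis"
begin

definition isometric_metrics :: "'a metric \<Rightarrow> 'b metric \<Rightarrow> bool" where
  "isometric_metrics X Y \<longleftrightarrow>
     (\<exists>f. bij_betw f (mspace X) (mspace Y) \<and>
          (\<forall>x\<in>mspace X. \<forall>y\<in>mspace X. mdist Y (f x) (f y) = mdist X x y))"

definition hausdorff_dist :: "'a metric \<Rightarrow> 'a set \<Rightarrow> 'a set \<Rightarrow> ennreal" where
  "hausdorff_dist Z A B =
     max (SUP a\<in>A. INF b\<in>B. ennreal (mdist Z a b)) (SUP b\<in>B. INF a\<in>A. ennreal (mdist Z a b))"

text \<open>HOL cannot quantify over metric spaces on arbitrary types inside a term. The ambient space
  \<open>Z\<close> therefore ranges over all metric spaces with carrier in the disjoint sum of the two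
  underlying types. No smaller value arises from an ambient space of any other type, as the
  lemma \<open>gh_dist_le\<close> below shows: only the union of the two subsets matters, and
  it embeds into the sum type.\<close>

definition gh_dist :: "'a metric \<Rightarrow> 'b metric \<Rightarrow> ennreal" where
  "gh_dist X Y =
     Inf {hausdorff_dist Z A B | (Z :: ('a + 'b) metric) A B.
            A \<subseteq> mspace Z \<and> B \<subseteq> mspace Z \<and>
            isometric_metrics (submetric Z A) X \<and> isometric_metrics (submetric Z B) Y}"

definition gh_finite_rel :: "('a metric \<times> 'a metric) set" where
  "gh_finite_rel = {(X, Y). mspace X \<noteq> {} \<and> mspace Y \<noteq> {} \<and> gh_dist X Y < \<infinity>}"

text \<open>The cloud containing \<open>X\<close>, as seen among the metric spaces carried by subsets of the type
  \<open>'a\<close>.\<close>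

definition cloud :: "'a metric \<Rightarrow> 'a metric set" where
  "cloud X = gh_finite_rel `` {X}"

text \<open>Meaningful for \<open>c > 0\<close> only.\<close>

definition scale_metric :: "real \<Rightarrow> 'a metric \<Rightarrow> 'a metric" where
  "scale_metric c X = metric (mspace X, \<lambda>x y. c * mdist X x y)"

definition X_space :: "real \<Rightarrow> (nat \<Rightarrow> real) \<Rightarrow> real metric" where
  "X_space q \<phi> = submetric euclidean_metric {q powr \<phi> n | n. n \<ge> 1}"

lemma Metric_space_scale:
  assumes "c > 0"
  shows "Metric_space (mspace X) (\<lambda>x y. c * mdist X x y)"
proof
  fix x y z assume "x \<in> mspace X" "y \<in> mspace X" "z \<in> mspace X"
  then have "mdist X x z \<le> mdist X x y + mdist X y z"
    by (meson Metric_space.triangle Metric_space_mspace_mdist)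
  then show "c * mdist X x z \<le> c * mdist X x y + c * mdist X y z"
    using assms by (simp flip: distrib_left)
qed (use assms in \<open>auto simp: mdist_commute\<close>)

lemma mspace_scale_metric [simp]: "c > 0 \<Longrightarrow> mspace (scale_metric c X) = mspace X"
  by (simp add: scale_metric_def Metric_space.mspace_metric[OF Metric_space_scale])

lemma mdist_scale_metric [simp]:
  "c > 0 \<Longrightarrow> mdist (scale_metric c X) = (\<lambda>x y. c * mdist X x y)"
  by (simp add: scale_metric_def Metric_space.mdist_metric[OF Metric_space_scale])

lemma isometric_metrics_sym:
  assumes "isometric_metrics X Y"
  shows "isometric_metrics Y X"
proof -
  obtain f where f: "bij_betw f (mspace X) (mspace Y)"
    and d: "\<And>x y. x \<in> mspace X \<Longrightarrow> y \<in> mspace X \<Longrightarrow> mdist Y (f x) (f y) = mdist X x y"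
    using assms unfolding isometric_metrics_def by blast
  let ?g = "inv_into (mspace X) f"
  have g: "bij_betw ?g (mspace Y) (mspace X)"
    using f by (rule bij_betw_inv_into)
  moreover have "mdist X (?g x) (?g y) = mdist Y x y"
    if "x \<in> mspace Y" "y \<in> mspace Y" for x y
    using d[of "?g x" "?g y"] that bij_betw_apply[OF g] bij_betw_inv_into_right[OF f] by simp
  ultimately show ?thesis
    unfolding isometric_metrics_def by blast
qed

lemma isometric_metrics_trans:
  assumes "isometric_metrics X Y" "isometric_metrics Y Z"
  shows "isometric_metrics X Z"
proof -
  obtain f g where f: "bij_betw f (mspace X) (mspace Y)" and g: "bij_betw g (mspace Y) (mspace Z)"
    and "\<And>x y. x \<in> mspace X \<Longrightarrow> y \<in> mspace X \<Longrightarrow> mdist Y (f x) (f y) = mdist X x y"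
    and "\<And>x y. x \<in> mspace Y \<Longrightarrow> y \<in> mspace Y \<Longrightarrow> mdist Z (g x) (g y) = mdist Y x y"
    using assms unfolding isometric_metrics_def by blast
  then have "\<forall>x\<in>mspace X. \<forall>y\<in>mspace X. mdist Z ((g \<circ> f) x) ((g \<circ> f) y) = mdist X x y"
    using bij_betw_apply[OF f] by simp
  then show ?thesis
    using bij_betw_trans[OF f g] unfolding isometric_metrics_def by blast
qed

lemma gh_dist_le:
  fixes X :: "'a metric" and Y :: "'b metric" and Z :: "'c metric"
  assumes A: "A \<subseteq> mspace Z" and B: "B \<subseteq> mspace Z"
    and AX: "isometric_metrics (submetric Z A) X" and BY: "isometric_metrics (submetric Z B) Y"
  shows "gh_dist X Y \<le> hausdorff_dist Z A B"
proof -
  obtain f where f: "bij_betw f (mspace X) A"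
    using isometric_metrics_sym[OF AX] A unfolding isometric_metrics_def
    by (auto simp: inf_absorb1)
  obtain g where g: "bij_betw g (mspace Y) B"
    using isometric_metrics_sym[OF BY] B unfolding isometric_metrics_def
    by (auto simp: inf_absorb1)
  define k where "k = case_sum f g"
  define M where "M = Inl ` mspace X \<union> Inr ` {y \<in> mspace Y. g y \<notin> A}"
  have k: "bij_betw k M (A \<union> B)"
  proof (rule bij_betw_imageI)
    have *: "f x \<in> A" if "x \<in> mspace X" for x
      using f that by (rule bij_betw_apply)
    show "inj_on k M"
    proof (rule inj_onI)
      fix u v assume uv: "u \<in> M" "v \<in> M" "k u = k v"
      show "u = v"
      proof (cases u; cases v)
        fix x x' assume "u = Inl x" "v = Inl x'"
        then show ?thesis
          using uv inj_onD[OF bij_betw_imp_inj_on[OF f]] by (auto simp: M_def k_def)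
      next
        fix y y' assume "u = Inr y" "v = Inr y'"
        then show ?thesis
          using uv inj_onD[OF bij_betw_imp_inj_on[OF g]] by (auto simp: M_def k_def)
      next
        fix x y assume "u = Inl x" "v = Inr y"
        then show ?thesis
          using uv *[of x] by (auto simp: M_def k_def)
      next
        fix x y assume "u = Inr y" "v = Inl x"
        then show ?thesis
          using uv *[of x] by (auto simp: M_def k_def)
      qed
    qed
    have "k ` M = f ` mspace X \<union> (g ` mspace Y - A)"
      unfolding M_def k_def image_Un image_image by auto
    then show "k ` M = A \<union> B"
      using bij_betw_imp_surj_on[OF f] bij_betw_imp_surj_on[OF g] by auto
  qed
  have kM: "k u \<in> mspace Z" if "u \<in> M" for u
    using bij_betw_apply[OF k that] A B by auto
  define W where "W = metric (M, \<lambda>u v. mdist Z (k u) (k v))"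
  have ms: "Metric_space M (\<lambda>u v. mdist Z (k u) (k v))"
  proof
    fix u v w assume "u \<in> M" "v \<in> M" "w \<in> M"
    then show "mdist Z (k u) (k w) \<le> mdist Z (k u) (k v) + mdist Z (k v) (k w)"
      by (meson kM Metric_space.triangle Metric_space_mspace_mdist)
  next
    fix u v assume "u \<in> M" "v \<in> M"
    then show "mdist Z (k u) (k v) = 0 \<longleftrightarrow> u = v"
      using kM by (simp add: inj_on_eq_iff[OF bij_betw_imp_inj_on[OF k]])
  qed (auto simp: mdist_commute)
  have W: "mspace W = M" "mdist W = (\<lambda>u v. mdist Z (k u) (k v))"
    by (simp_all add: W_def Metric_space.mspace_metric[OF ms] Metric_space.mdist_metric[OF ms])
  define pre where "pre = (\<lambda>S. {u \<in> M. k u \<in> S})"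
  have im: "k ` pre S = S" if "S \<subseteq> A \<union> B" for S
  proof
    show "k ` pre S \<subseteq> S"
      by (auto simp: pre_def)
    show "S \<subseteq> k ` pre S"
      using that bij_betw_imp_surj_on[OF k] by (force simp: pre_def)
  qed
  have iso: "isometric_metrics (submetric W (pre S)) (submetric Z S)"
    if "S \<subseteq> A \<union> B" for S
  proof -
    have "inj_on k (pre S)"
      by (rule inj_on_subset[OF bij_betw_imp_inj_on[OF k]]) (auto simp: pre_def)
    then have "bij_betw k (pre S) S"
      using im[OF that] by (simp add: bij_betw_def)
    moreover have "pre S \<inter> M = pre S" "S \<inter> mspace Z = S"
      using that A B by (auto simp: pre_def)
    ultimately show ?thesis
      unfolding isometric_metrics_def by (intro exI[of _ k]) (simp add: W)
  qed
  have "hausdorff_dist W (pre A) (pre B) = hausdorff_dist Z (k ` pre A) (k ` pre B)"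
    by (simp add: hausdorff_dist_def W image_image)
  also have "\<dots> = hausdorff_dist Z A B"
    by (simp add: im)
  finally have eq: "hausdorff_dist Z A B = hausdorff_dist W (pre A) (pre B)" ..
  have "pre A \<subseteq> mspace W" "pre B \<subseteq> mspace W"
    by (auto simp: W pre_def)
  moreover have "isometric_metrics (submetric W (pre A)) X" "isometric_metrics (submetric W (pre B)) Y"
    using isometric_metrics_trans[OF iso AX] isometric_metrics_trans[OF iso BY] by simp_all
  ultimately show ?thesis
    unfolding gh_dist_def eq
    by (intro Inf_lower CollectI exI[of _ W] exI[of _ "pre A"] exI[of _ "pre B"] conjI refl)
qed

end

theory Submission
  imports Defs
begin

text \<open>A finite Gromov--Hausdorff distance yields a map \<open>h\<close> from \<open>X\<^sub>\<phi>\<close> to itself that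
  multiplies distances by \<open>1/\<lambda>\<close> up to a bounded error. As \<open>X\<^sub>\<phi>\<close> lies on the positive half-line,
  \<open>h x\<close> is within bounded distance of \<open>x/\<lambda>\<close>. But the points of \<open>X\<^sub>\<phi>\<close> grow
  superexponentially, so for a large point \<open>x\<close> any other point is either much larger or much
  smaller than \<open>x\<close>, and the distance from \<open>x/\<lambda>\<close> to \<open>X\<^sub>\<phi>\<close> is unbounded unless \<open>\<lambda> = 1\<close>.\<close>

section \<open>Maps extracted from a finite distance\<close>

lemma hausdorff_dist_finiteE:
  assumes "hausdorff_dist Z A B < \<infinity>"
  obtains r where "\<And>a. a \<in> A \<Longrightarrow> \<exists>b\<in>B. mdist Z a b < r"
proof -
  \<comment> \<open>A strict bound, because the infimum over \<open>B\<close> need not be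
    attained.\<close>
  obtain r where r: "hausdorff_dist Z A B < ennreal r"
    using assms by (metis ennreal_cases infinity_ennreal_def less_top dense)
  have "\<exists>b\<in>B. mdist Z a b < r" if "a \<in> A" for a
  proof -
    have "(INF b\<in>B. ennreal (mdist Z a b)) \<le> hausdorff_dist Z A B"
      unfolding hausdorff_dist_def by (rule max.coboundedI1, rule SUP_upper[OF that])
    then have "(INF b\<in>B. ennreal (mdist Z a b)) < ennreal r"
      using r by (rule le_less_trans)
    then show ?thesis
      by (auto simp: INF_less_iff ennreal_less_iff)
  qed
  then show thesis
    using that by blast
qed

text \<open>\<open>h\<close> passes from \<open>X\<close> to its copy \<open>A\<close>, jumps by
  less than \<open>r\<close> to a point of \<open>B\<close>, and continues to \<open>Y\<close>. Only
  the jumps distort distances, and there is one at each of the two endpoints, hence the bound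
  \<open>2 * r\<close>.\<close>

lemma gh_dist_finiteE:
  fixes X :: "'a metric" and Y :: "'b metric"
  assumes "gh_dist X Y < \<infinity>"
  obtains h C where "h \<in> mspace X \<rightarrow> mspace Y"
    and "\<And>x x'. x \<in> mspace X \<Longrightarrow> x' \<in> mspace X \<Longrightarrow> \<bar>mdist Y (h x) (h x') - mdist X x x'\<bar> \<le> C"
proof -
  obtain Z :: "('a + 'b) metric" and A B where A: "A \<subseteq> mspace Z" and B: "B \<subseteq> mspace Z"
    and AX: "isometric_metrics (submetric Z A) X" and BY: "isometric_metrics (submetric Z B) Y"
    and fin: "hausdorff_dist Z A B < \<infinity>"
    using assms unfolding gh_dist_def by (auto simp only: Inf_less_iff mem_Collect_eq)
  have carrier: "mspace (submetric Z A) = A" "mspace (submetric Z B) = B"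
    using A B by (auto simp: inf_absorb1)
  obtain f where f: "f ` mspace X = A"
    and df: "\<And>x x'. x \<in> mspace X \<Longrightarrow> x' \<in> mspace X \<Longrightarrow> mdist Z (f x) (f x') = mdist X x x'"
    using isometric_metrics_sym[OF AX] unfolding isometric_metrics_def bij_betw_def carrier
    by (auto simp only: mdist_submetric)
  obtain g where g: "g ` B = mspace Y"
    and dg: "\<And>b b'. b \<in> B \<Longrightarrow> b' \<in> B \<Longrightarrow> mdist Y (g b) (g b') = mdist Z b b'"
    using BY unfolding isometric_metrics_def bij_betw_def carrier
    by (auto simp only: mdist_submetric)
  obtain r where "\<And>a. a \<in> A \<Longrightarrow> \<exists>b\<in>B. mdist Z a b < r"
    using fin by (rule hausdorff_dist_finiteE) blast
  then obtain p where p: "\<And>a. a \<in> A \<Longrightarrow> p a \<in> B" "\<And>a. a \<in> A \<Longrightarrow> mdist Z a (p a) < r"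
    by metis
  have close: "\<bar>mdist Z (p a) (p a') - mdist Z a a'\<bar> \<le> 2 * r" if a: "a \<in> A" "a' \<in> A" for a a'
  proof -
    interpret Metric_space "mspace Z" "mdist Z"
      by (rule Metric_space_mspace_mdist)
    have "a \<in> mspace Z" "a' \<in> mspace Z" "p a \<in> mspace Z" "p a' \<in> mspace Z"
      using a p(1) A B by auto
    then show ?thesis
      using triangle[of a "p a" a'] triangle[of "p a" "p a'" a']
        triangle[of "p a" a "p a'"] triangle[of a a' "p a'"] p(2)[OF a(1)] p(2)[OF a(2)]
        commute[of a "p a"] commute[of a' "p a'"]
      by linarith
  qed
  have fA: "f x \<in> A" if "x \<in> mspace X" for x
    using f that by blast
  show thesis
  proof (rule that[of "g \<circ> p \<circ> f" "2 * r"])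
    show "g \<circ> p \<circ> f \<in> mspace X \<rightarrow> mspace Y"
      using p(1) fA g by auto
    show "\<bar>mdist Y ((g \<circ> p \<circ> f) x) ((g \<circ> p \<circ> f) x') - mdist X x x'\<bar> \<le> 2 * r"
      if "x \<in> mspace X" "x' \<in> mspace X" for x x'
      using close[OF fA fA, OF that] dg[OF p(1) p(1), OF fA fA, OF that] df[OF that] by simp
  qed
qed

section \<open>The case of coefficient 1\<close>

lemma hausdorff_dist_self: "A \<subseteq> mspace Z \<Longrightarrow> hausdorff_dist Z A A = 0"
proof -
  assume A: "A \<subseteq> mspace Z"
  have "(INF b\<in>A. ennreal (mdist Z a b)) = 0" "(INF b\<in>A. ennreal (mdist Z b a)) = 0"
    if "a \<in> A" for a
    using A that by (auto intro!: antisym INF_lower2[OF that])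
  then show ?thesis
    by (cases "A = {}") (auto simp: hausdorff_dist_def bot_ennreal)
qed

lemma gh_dist_self: "gh_dist X X = 0"
proof -
  have "isometric_metrics X X"
    unfolding isometric_metrics_def by (rule exI[of _ id]) auto
  \<comment> \<open>\<open>gh_dist_le\<close> accepts an ambient space on any type, so
    \<open>X\<close> itself serves.\<close>
  then have "gh_dist X X \<le> hausdorff_dist X (mspace X) (mspace X)"
    by (intro gh_dist_le) auto
  then show ?thesis
    by (simp add: hausdorff_dist_self)
qed

lemma scale_metric_1: "scale_metric 1 X = X"
  by (simp add: scale_metric_def mspace_def mdist_def dest_metric_inverse)

section \<open>Sequences whose consecutive ratios tend to infinity\<close>

text \<open>From some index \<open>N\<close> on, each term at least doubles, so the sequence
  dominates a geometric one.\<close>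

lemma rapid_growth_filterlim:
  fixes a :: "nat \<Rightarrow> real"
  assumes pos: "\<And>n. a n > 0" and ratio: "filterlim (\<lambda>n. a (Suc n) / a n) at_top sequentially"
  shows "filterlim a at_top sequentially"
proof -
  obtain N where N: "\<And>n. n \<ge> N \<Longrightarrow> 2 \<le> a (Suc n) / a n"
    using ratio unfolding filterlim_at_top eventually_sequentially by blast
  have "2 ^ k * a N \<le> a (k + N)" for k
  proof (induction k)
    case (Suc k)
    have "2 * a (k + N) \<le> a (Suc (k + N))"
      using N[of "k + N"] pos[of "k + N"] by (simp add: field_simps)
    with Suc show ?case
      by simp
  qed simp
  moreover have "filterlim (\<lambda>k. 2 ^ k * a N) at_top sequentially"
    by (intro filterlim_at_top_mult_tendsto_pos[OF tendsto_const pos]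
        filterlim_at_infinity_imp_filterlim_at_top[OF filterlim_realpow_sequentially_gt1]) auto
  ultimately have "filterlim (\<lambda>k. a (k + N)) at_top sequentially"
    by (auto intro: filterlim_at_top_mono)
  then show ?thesis
    by (simp add: filterlim_iff eventually_sequentially_seg[where P = "\<lambda>n. P (a n)" for P])
qed

lemma rapid_growth_dominates:
  fixes a :: "nat \<Rightarrow> real"
  assumes pos: "\<And>n. a n > 0" and ratio: "filterlim (\<lambda>n. a (Suc n) / a n) at_top sequentially"
  shows "\<forall>\<^sub>F n in sequentially. (\<forall>m<n. K * a m \<le> a n) \<and> (\<forall>m>n. K * a n \<le> a m)"
proof -
  \<comment> \<open>A factor of at least 1 makes the sequence nondecreasing from \<open>N\<close>
    on, which carries the induction in \<open>far\<close>.\<close>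
  define L where "L = max K 1"
  have L: "L \<ge> 1" and KL: "K * a n \<le> L * a n" for n
    using pos[of n] by (auto simp: L_def intro: mult_right_mono)
  obtain N where N: "\<And>n. n \<ge> N \<Longrightarrow> L \<le> a (Suc n) / a n"
    using ratio unfolding filterlim_at_top eventually_sequentially by blast
  have step: "L * a n \<le> a (Suc n)" if "n \<ge> N" for n
    using N[OF that] pos[of n] by (simp add: field_simps)
  have far: "L * a m \<le> a n" if "N \<le> m" "m < n" for m n
    using that(2)
  proof (induction n)
    case (Suc n)
    show ?case
    proof (cases "m = n")
      case True
      then show ?thesis using step that(1) by simp
    next
      case False
      then have "L * a m \<le> a n" "N \<le> n"
        using Suc that(1) by auto
      moreover have "a n \<le> L * a n"
        using L pos[of n] by simp
      ultimately show ?thesis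
        using step[of n] by linarith
    qed
  qed simp
  \<comment> \<open>The ratios give no control below \<open>N\<close>, but these are finitely many
    fixed values and the sequence is unbounded.\<close>
  have "\<forall>\<^sub>F n in sequentially. \<forall>m\<in>{..<N}. L * a m \<le> a n"
    using rapid_growth_filterlim[OF assms]
    by (intro eventually_ball_finite) (auto simp: filterlim_at_top)
  then show ?thesis
    using eventually_ge_at_top[of N]
  proof eventually_elim
    case (elim n)
    have "L * a m \<le> a n" if "m < n" for m
      using elim(1) far[of m n] that by (cases "m < N") auto
    then show ?case
      using far[of n] elim(2) KL order_trans by blast
  qed
qed

lemma rapid_growth_avoids_multiples:
  fixes a :: "nat \<Rightarrow> real"
  assumes pos: "\<And>n. a n > 0" and ratio: "filterlim (\<lambda>n. a (Suc n) / a n) at_top sequentially"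
    and c: "c > 0" "c \<noteq> 1"
  shows "\<forall>\<^sub>F n in sequentially. \<forall>m. D < \<bar>a m - c * a n\<bar>"
proof -
  \<comment> \<open>The three entries bound the gap relative to \<open>a n\<close> when m = n, m > n
    and m < n: in the last two cases \<open>a m\<close> is at least \<open>(c + 1) * a n\<close> or
    at most \<open>c / 2 * a n\<close>.\<close>
  define \<delta> where "\<delta> = min \<bar>1 - c\<bar> (min 1 (c / 2))"
  have \<delta>: "\<delta> > 0" "\<delta> \<le> \<bar>1 - c\<bar>" "\<delta> \<le> 1" "\<delta> \<le> c / 2"
    using c unfolding \<delta>_def by linarith+
  have "\<forall>\<^sub>F n in sequentially. D / \<delta> < a n"
    using rapid_growth_filterlim[OF pos ratio] by (simp add: filterlim_at_top_dense)
  then show ?thesis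
    using rapid_growth_dominates[OF pos ratio, of "c + 1"]
      rapid_growth_dominates[OF pos ratio, of "2 / c"]
  proof eventually_elim
    case (elim n)
    have "\<delta> * a n \<le> \<bar>a m - c * a n\<bar>" for m
    proof (cases rule: linorder_cases[of m n])
      case less
      then have "a m \<le> c / 2 * a n"
        using elim(3) c by (auto simp: field_simps)
      moreover have "\<delta> * a n \<le> c / 2 * a n"
        using \<delta>(4) pos[of n] by (intro mult_right_mono) auto
      ultimately show ?thesis
        by simp
    next
      case equal
      have "\<bar>a n - c * a n\<bar> = \<bar>1 - c\<bar> * a n"
        using abs_mult[of "1 - c" "a n"] pos[of n] by (simp add: left_diff_distrib)
      then show ?thesis
        using \<delta>(2) pos[of n] equal by (simp add: mult_right_mono)
    next
      case greater
      then have "(c + 1) * a n \<le> a m"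
        using elim(2) by blast
      moreover have "\<delta> * a n \<le> 1 * a n"
        using \<delta>(3) pos[of n] by (intro mult_right_mono) auto
      ultimately show ?thesis
        by (simp add: distrib_right)
    qed
    moreover have "D < \<delta> * a n"
      using elim(1) \<delta>(1) by (simp add: field_simps)
    ultimately show ?case
      by (auto intro: less_le_trans)
  qed
qed

section \<open>The space of powers and its rescalings\<close>

lemma powr_ratio_at_top:
  fixes \<phi> :: "nat \<Rightarrow> real"
  assumes "filterlim (\<lambda>n. \<phi> (n + 1) - \<phi> n) at_top sequentially" "q > 1"
  shows "filterlim (\<lambda>n. q powr \<phi> (Suc n) / q powr \<phi> n) at_top sequentially"
proof -
  have "filterlim (\<lambda>n. exp ((\<phi> (n + 1) - \<phi> n) * ln q)) at_top sequentially"
    using assms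
    by (intro filterlim_compose[OF exp_at_top] filterlim_at_top_mult_tendsto_pos[OF tendsto_const]) auto
  then show ?thesis
    using assms(2) by (simp add: powr_def left_diff_distrib flip: exp_diff)
qed

lemma mspace_X_space [simp]: "mspace (X_space q \<phi>) = {q powr \<phi> n | n. n \<ge> 1}"
  and mdist_X_space [simp]: "mdist (X_space q \<phi>) x y = \<bar>x - y\<bar>"
  by (simp_all add: X_space_def dist_real_def)

text \<open>Fix a base point \<open>y\<close>. On the positive half-line,
  \<open>\<bar>x - y\<bar>\<close> differs from \<open>x\<close> by at most \<open>y\<close>, and
  likewise for the images, so comparing distances to \<open>y\<close> compares the points
  themselves. Without positivity, \<open>h\<close> could also reverse the sign.\<close>

lemma almost_similarity_on_positive_reals:
  fixes h :: "real \<Rightarrow> real"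
  assumes "lambda > 0" "\<And>x. x \<in> S \<Longrightarrow> x > 0" "h \<in> S \<rightarrow> S"
    and "\<And>x x'. x \<in> S \<Longrightarrow> x' \<in> S \<Longrightarrow> \<bar>lambda * \<bar>h x - h x'\<bar> - \<bar>x - x'\<bar>\<bar> \<le> C"
  shows "\<exists>D. \<forall>x\<in>S. \<bar>h x - 1 / lambda * x\<bar> \<le> D"
proof (cases "S = {}")
  case False
  then obtain y where y: "y \<in> S"
    by blast
  have "\<bar>h x - 1 / lambda * x\<bar> \<le> (C + lambda * h y + y) / lambda" if x: "x \<in> S" for x
  proof -
    have "h x \<in> S" "h y \<in> S"
      using x y assms(3) by auto
    then have p: "x > 0" "y > 0" "lambda * h x > 0" "lambda * h y > 0"
      using x y assms(1,2) by auto
    have "lambda * \<bar>h x - h y\<bar> = \<bar>lambda * h x - lambda * h y\<bar>"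
      using assms(1) by (simp add: abs_mult flip: right_diff_distrib)
    then have "\<bar>lambda * h x - x\<bar> \<le> C + lambda * h y + y"
      using assms(4)[OF x y] p by linarith
    moreover have "\<bar>h x - 1 / lambda * x\<bar> = \<bar>lambda * h x - x\<bar> / lambda"
      using abs_divide[of "lambda * h x - x" lambda] assms(1) by (simp add: diff_divide_distrib)
    ultimately show ?thesis
      using assms(1) by (simp add: divide_right_mono)
  qed
  then show ?thesis
    by blast
qed simp

theorem theorem5p8:
  fixes \<phi> :: "nat \<Rightarrow> real" and q lambda :: real
  assumes "filterlim (\<lambda>n. \<phi> (n + 1) - \<phi> n) at_top sequentially"
    and "q > 1" and "lambda > 0"
  shows "scale_metric lambda (X_space q \<phi>) \<in> cloud (X_space q \<phi>) \<longleftrightarrow> lambda = 1"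
proof
  let ?X = "X_space q \<phi>"
  assume "scale_metric lambda ?X \<in> cloud ?X"
  then have "gh_dist ?X (scale_metric lambda ?X) < \<infinity>"
    by (simp add: cloud_def gh_finite_rel_def)
  then obtain h C where h: "h \<in> mspace ?X \<rightarrow> mspace (scale_metric lambda ?X)"
    and hC: "\<And>x x'. x \<in> mspace ?X \<Longrightarrow> x' \<in> mspace ?X \<Longrightarrow>
      \<bar>mdist (scale_metric lambda ?X) (h x) (h x') - mdist ?X x x'\<bar> \<le> C"
    by (rule gh_dist_finiteE) blast
  \<comment> \<open>Distances in the target carry the factor \<open>lambda\<close>, so in the usual
    metric \<open>h\<close> almost scales by \<open>1 / lambda\<close>.\<close>
  have "\<exists>D. \<forall>x\<in>mspace ?X. \<bar>h x - 1 / lambda * x\<bar> \<le> D"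
  proof (rule almost_similarity_on_positive_reals[where C = C])
    show "\<bar>lambda * \<bar>h x - h x'\<bar> - \<bar>x - x'\<bar>\<bar> \<le> C"
      if "x \<in> mspace ?X" "x' \<in> mspace ?X" for x x'
      using hC[OF that] assms(3) by simp
  qed (use h assms(2,3) in auto)
  then obtain D where D: "\<And>x. x \<in> mspace ?X \<Longrightarrow> \<bar>h x - 1 / lambda * x\<bar> \<le> D"
    by blast
  show "lambda = 1"
  proof (rule ccontr)
    assume "lambda \<noteq> 1"
    then have "\<forall>\<^sub>F n in sequentially. \<forall>m. D < \<bar>q powr \<phi> m - 1 / lambda * q powr \<phi> n\<bar>"
      using assms(2,3) by (intro rapid_growth_avoids_multiples powr_ratio_at_top assms(1)) auto
    \<comment> \<open>Index 0 contributes no point to \<open>X_space\<close>, so it is excluded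
      before evaluating \<open>h\<close>.\<close>
    then have "\<forall>\<^sub>F n in sequentially. n \<ge> 1 \<and> (\<forall>m. D < \<bar>q powr \<phi> m - 1 / lambda * q powr \<phi> n\<bar>)"
      using eventually_ge_at_top[of 1] by eventually_elim simp
    then obtain n where n: "n \<ge> 1" "\<And>m. D < \<bar>q powr \<phi> m - 1 / lambda * q powr \<phi> n\<bar>"
      by (auto simp: eventually_sequentially)
    then have nX: "q powr \<phi> n \<in> mspace ?X"
      by auto
    then obtain m where "h (q powr \<phi> n) = q powr \<phi> m"
      using h assms(3) by fastforce
    then show False
      using D[OF nX] n(2)[of m] by simp
  qed
next
  assume "lambda = 1"
  then show "scale_metric lambda (X_space q \<phi>) \<in> cloud (X_space q \<phi>)"
    by (auto simp: scale_metric_1 cloud_def gh_finite_rel_def gh_dist_self)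
qed

end
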